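(* Let $\Omega,\Omega'\subset\mathbb{C}$ be plane domains with smooth conformal metrics $\rho=\rho(z)|dz|$ and $\sigma=\sigma(w)|dw|$, respectively, and let $f:\Omega\to\Omega'$ be a non-constant holomorphic map. Let $\Sigma^n f=\Sigma^n_{\sigma,\rho}f$ ($n\ge 0$) be the invariant Schwarzian derivative of virtual order $n$ of $f$. Then, for every integer $n\ge 3$, $$ \Sigma^{n}f=\big(\partial_\rho-(n-1)\,\partial_\rho\log\rho\big)\Sigma^{n-1}f +\frac12\,\Sigma^2f\sum_{k=1}^{n-1} \binom{n}{k}\,\Sigma^{k-1}f\; \Sigma^{n-k-1}f $$ at the points of $\Omega$ where $f'\neq 0$. Here $(\partial_\rho-(n-1)\partial_\rho\log\rho)\Sigma^{n-1}f$ means $\partial_\rho(\Sigma^{n-1}f)-(n-1)(\partial_\rho\log\rho)\cdot\Sigma^{n-1}f$.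
   Context: A smooth conformal metric $\rho=\rho(z)|dz|$ on a plane domain $\Omega$ is given by a smooth positive function $\rho(z)$ on $\Omega$. For a smooth complex-valued function $\varphi$ on $\Omega$, $\partial_\rho\varphi=\frac{1}{\rho(z)}\frac{\partial\varphi}{\partial z}$, where $\partial/\partial z=\frac12(\partial_x-i\partial_y)$; similarly $\partial_\sigma$ on $\Omega'$. Peschl--Minda derivatives: for holomorphic $f:\Omega\to\Omega'$, define $D^nf=D^n_{\sigma,\rho}f$ inductively by $$D^1f=\frac{\sigma\circ f}{\rho}f',\qquad D^{n+1}f=\partial_\rho(D^nf)+\left[-n\,\partial_\rho\log\rho+\big((\partial_\sigma\log\sigma)\circ f\big)\cdot D^1f\right]D^nf\quad(n\ge1).$$ For non-constant $f$ put $Q^nf=\dfrac{D^{n+1}f}{D^1f}$ for $n\ge1$; this is defined where $f'\ne0$. Polynomials $P_n$: let $R=\mathbb{Z}[\tfrac12]$ and let $\mathcal{E}$ be the $R$-derivation of $R[x_1,x_2,\dots]$ given by $\mathcal{E}P=\sum_{m\ge1}(x_{m+1}-x_1x_m)\frac{\partial P}{\partial x_m}$. Define $P_0=1$, $P_1=0$, $P_2=x_2-\frac32x_1^2$ and $$P_{n}=\mathcal{E} P_{n-1}+\frac12 P_2\sum_{k=1}^{n-1} \binom{n}{k}P_{k-1}P_{n-k-1},\quad n\ge3.$$ Each $P_n$ lies in $R[x_1,\dots,x_n]$. The invariant Schwarzian derivative of virtual order $n$ is $\Sigma^nf=P_n(Q^1f,\dots,Q^nf)$. *)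

theory Defs
  imports
    "HOL-Analysis.Analysis"
    "HOL-Library.Poly_Mapping"
    "HOL-Library.Float"
begin

subsection \<open>Smooth functions and conformal metrics\<close>

text \<open>
  \<open>Ck_on k S f\<close>: on the open set \<open>S\<close>, \<open>f\<close> is \<open>k\<close> times continuously differentiable in the real
  sense.
\<close>

fun Ck_on :: "nat \<Rightarrow> 'a::real_normed_vector set \<Rightarrow> ('a \<Rightarrow> 'b::real_normed_vector) \<Rightarrow> bool" where
  "Ck_on 0 S f \<longleftrightarrow> continuous_on S f"
| "Ck_on (Suc k) S f \<longleftrightarrow>
     (\<forall>x\<in>S. f differentiable (at x)) \<and> (\<forall>v. Ck_on k S (\<lambda>x. frechet_derivative f (at x) v))"

definition smooth_on :: "'a::real_normed_vector set \<Rightarrow> ('a \<Rightarrow> 'b::real_normed_vector) \<Rightarrow> bool" where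
  "smooth_on S f \<longleftrightarrow> (\<forall>k. Ck_on k S f)"

definition plane_domain :: "complex set \<Rightarrow> bool" where
  "plane_domain \<Omega> \<longleftrightarrow> open \<Omega> \<and> connected \<Omega> \<and> \<Omega> \<noteq> {}"

text \<open>A metric \<open>\<rho>(z) |dz|\<close> is represented by its density \<open>\<rho>\<close>, of which only the values on the
  domain matter.\<close>

definition smooth_conformal_metric :: "complex set \<Rightarrow> (complex \<Rightarrow> real) \<Rightarrow> bool" where
  "smooth_conformal_metric \<Omega> \<rho> \<longleftrightarrow> smooth_on \<Omega> \<rho> \<and> (\<forall>z\<in>\<Omega>. \<rho> z > 0)"

text \<open>\<open>\<partial>/\<partial>z = (\<partial>\<^sub>x - \<i> \<partial>\<^sub>y)/2\<close>; the partial derivatives are the values of the real Frechet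
  derivative at \<open>1\<close> and \<open>\<i>\<close>.\<close>

definition dz :: "(complex \<Rightarrow> complex) \<Rightarrow> complex \<Rightarrow> complex" where
  "dz \<phi> z = (frechet_derivative \<phi> (at z) 1 - \<i> * frechet_derivative \<phi> (at z) \<i>) / 2"

definition d_metric :: "(complex \<Rightarrow> real) \<Rightarrow> (complex \<Rightarrow> complex) \<Rightarrow> complex \<Rightarrow> complex" where
  "d_metric \<rho> \<phi> z = dz \<phi> z / complex_of_real (\<rho> z)"

definition d_log :: "(complex \<Rightarrow> real) \<Rightarrow> complex \<Rightarrow> complex" where
  "d_log \<rho> = d_metric \<rho> (\<lambda>z. complex_of_real (ln (\<rho> z)))"

subsection \<open>Peschl--Minda derivatives\<close>

text \<open>\<open>PM_deriv \<sigma> \<rho> f n\<close> is \<open>D\<^sup>n f\<close>; it is left unspecified for \<open>n = 0\<close>.\<close>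

fun PM_deriv ::
  "(complex \<Rightarrow> real) \<Rightarrow> (complex \<Rightarrow> real) \<Rightarrow> (complex \<Rightarrow> complex) \<Rightarrow> nat \<Rightarrow> complex \<Rightarrow> complex" where
  "PM_deriv \<sigma> \<rho> f (Suc 0) =
     (\<lambda>z. complex_of_real (\<sigma> (f z)) / complex_of_real (\<rho> z) * deriv f z)"
| "PM_deriv \<sigma> \<rho> f (Suc (Suc m)) =
     (\<lambda>z. d_metric \<rho> (PM_deriv \<sigma> \<rho> f (Suc m)) z
          + (- of_nat (Suc m) * d_log \<rho> z + d_log \<sigma> (f z) * PM_deriv \<sigma> \<rho> f 1 z)
            * PM_deriv \<sigma> \<rho> f (Suc m) z)"

definition Q ::
  "(complex \<Rightarrow> real) \<Rightarrow> (complex \<Rightarrow> real) \<Rightarrow> (complex \<Rightarrow> complex) \<Rightarrow> nat \<Rightarrow> complex \<Rightarrow> complex" where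
  "Q \<sigma> \<rho> f n z = PM_deriv \<sigma> \<rho> f (n + 1) z / PM_deriv \<sigma> \<rho> f 1 z"

subsection \<open>The polynomials\<close>

text \<open>
  The library type \<^typ>\<open>float\<close> consists of all dyadic rationals \<open>m * 2 powr e\<close> with integers \<open>m\<close>
  and \<open>e\<close>, without any rounding, and so is exactly the ring \<open>R = \<int>[1/2]\<close>.
  Polynomials over \<open>R\<close> are finitely supported maps from monomials (finitely supported exponent
  vectors) to coefficients, with the convolution product. The variables are \<open>x\<^sub>m\<close> for \<open>m :: nat\<close>;
  \<open>x\<^sub>0\<close> is never used.
\<close>

type_synonym dyadic_poly = "(nat \<Rightarrow>\<^sub>0 nat) \<Rightarrow>\<^sub>0 float"

definition Const :: "float \<Rightarrow> dyadic_poly" where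
  "Const c = Poly_Mapping.single 0 c"

definition X :: "nat \<Rightarrow> dyadic_poly" where
  "X m = Poly_Mapping.single (Poly_Mapping.single m 1) 1"

text \<open>\<open>\<partial>P/\<partial>x\<^sub>m\<close>; where the subtraction of exponents truncates, the coefficient vanishes.\<close>

definition pdiff :: "nat \<Rightarrow> dyadic_poly \<Rightarrow> dyadic_poly" where
  "pdiff m P = (\<Sum>t\<in>Poly_Mapping.keys P.
     Poly_Mapping.single (t - Poly_Mapping.single m 1)
       (of_nat (Poly_Mapping.lookup t m) * Poly_Mapping.lookup P t))"

text \<open>\<open>Sum_any\<close> sums over all indices; only finitely many terms are nonzero.\<close>

definition E_op :: "dyadic_poly \<Rightarrow> dyadic_poly" where
  "E_op P = Sum_any (\<lambda>m. (X (m + 1) - X 1 * X m) * pdiff m P when m \<ge> 1)"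

text \<open>Here \<^term>\<open>Float m e\<close> is the number \<open>m * 2 powr e\<close>.\<close>

function P_poly :: "nat \<Rightarrow> dyadic_poly" where
  "P_poly 0 = 1"
| "P_poly (Suc 0) = 0"
| "P_poly (Suc (Suc 0)) = X 2 - Const (Float 3 (-1)) * X 1 ^ 2"
| "n \<ge> 3 \<Longrightarrow> P_poly n =
     E_op (P_poly (n - 1)) + Const (Float 1 (-1)) * P_poly 2 *
       (\<Sum>k = 1..n-1. of_nat (n choose k) * P_poly (k - 1) * P_poly (n - k - 1))"
proof -
  fix R and n :: nat
  assume R: "n = 0 \<Longrightarrow> R" "n = Suc 0 \<Longrightarrow> R" "n = Suc (Suc 0) \<Longrightarrow> R" "\<And>m. m \<ge> 3 \<Longrightarrow> n = m \<Longrightarrow> R"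
  consider "n = 0" | "n = Suc 0" | "n = Suc (Suc 0)" | "n \<ge> 3" by linarith
  then show R using R by cases auto
qed auto
termination
  by (relation "Wellfounded.measure (\<lambda>n. n)") auto

definition poly_eval :: "(nat \<Rightarrow> complex) \<Rightarrow> dyadic_poly \<Rightarrow> complex" where
  "poly_eval a P =
     (\<Sum>t\<in>Poly_Mapping.keys P. complex_of_real (real_of_float (Poly_Mapping.lookup P t)) *
       (\<Prod>i\<in>Poly_Mapping.keys t. a i ^ Poly_Mapping.lookup t i))"

subsection \<open>Invariant Schwarzian derivatives\<close>

definition inv_Schwarzian ::
  "(complex \<Rightarrow> real) \<Rightarrow> (complex \<Rightarrow> real) \<Rightarrow> (complex \<Rightarrow> complex) \<Rightarrow> nat \<Rightarrow> complex \<Rightarrow> complex" where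
  "inv_Schwarzian \<sigma> \<rho> f n z = poly_eval (\<lambda>m. Q \<sigma> \<rho> f m z) (P_poly n)"

end

theory Submission
  imports Defs "HOL-Complex_Analysis.Cauchy_Integral_Formula"
begin

text \<open>
  Write \<open>L = \<partial>\<^sub>\<rho> log \<rho>\<close>. When the recursion of the Peschl--Minda derivatives is divided by \<open>D\<^sup>1 f\<close>,
  the contributions of \<open>\<sigma>\<close> to the derivatives of numerator and denominator cancel, and what is left is
  \<open>\<partial>\<^sub>\<rho> Q\<^sup>m f = Q\<^sup>m\<^sup>+\<^sup>1 f - Q\<^sup>1 f \<cdot> Q\<^sup>m f + m L \<cdot> Q\<^sup>m f\<close> (lemma \<open>d_metric_Q\<close>). By the chain rule,
  \<open>\<partial>\<^sub>\<rho>\<close> of \<open>P(Q\<^sup>1 f, Q\<^sup>2 f, \<dots>)\<close> is the sum over \<open>m\<close> of \<open>\<partial>P/\<partial>x\<^sub>m\<close> times this expression. The first two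
  terms add up to \<open>\<E> P\<close>, evaluated at the \<open>Q\<^sup>m f\<close>, since they are the coefficients of the
  derivation \<open>\<E>\<close>. The last terms add up to \<open>L\<close> times the Euler operator \<open>\<Sum> m x\<^sub>m \<partial>/\<partial>x\<^sub>m\<close> of the
  grading in which \<open>x\<^sub>m\<close> has weight \<open>m\<close>; on a homogeneous polynomial of weight \<open>d\<close> this operator
  is multiplication by \<open>d\<close>. So \<open>\<partial>\<^sub>\<rho> - d L\<close> on functions corresponds to \<open>\<E>\<close> on polynomials of
  weight \<open>d\<close> (lemma \<open>d_metric_poly_eval_homogeneous\<close>).

  The polynomial \<open>P\<^sub>n\<close> is homogeneous of weight \<open>n\<close> (lemma \<open>homogeneous_P_poly\<close>): \<open>\<E>\<close> raises the weight
  by one, and in each product \<open>P\<^sub>2 P\<^sub>k\<^sub>-\<^sub>1 P\<^sub>n\<^sub>-\<^sub>k\<^sub>-\<^sub>1\<close> the weights add up to \<open>n\<close>. Evaluating the recursion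
  of the \<open>P\<^sub>n\<close> at the \<open>Q\<^sup>m f\<close> therefore gives the recursion of the invariant Schwarzian derivatives.

  The analytic input is that all the \<open>Q\<^sup>m f\<close> are differentiable where \<open>f' \<noteq> 0\<close>. It comes from the
  smoothness of the \<open>D\<^sup>n f\<close> (lemma \<open>smooth_on_PM_deriv\<close>), for which smooth functions have to be closed
  under the operations in their recursion.
\<close>

section \<open>Smooth functions\<close>

lemma Ck_on_cong:
  assumes "open S" and "Ck_on k S f" and "\<And>x. x \<in> S \<Longrightarrow> f x = g x"
  shows "Ck_on k S g"
  using assms(2,3)
proof (induction k arbitrary: f g)
  case 0
  then show ?case by (simp cong: continuous_on_cong)
next
  case (Suc k)
  have g: "(g has_derivative frechet_derivative f (at x)) (at x)" if "x \<in> S" for x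
    by (rule has_derivative_transform_within_open[where f = f, OF _ assms(1) that])
      (use Suc.prems that in \<open>auto simp: frechet_derivative_works\<close>)
  have "frechet_derivative f (at x) = frechet_derivative g (at x)" if "x \<in> S" for x
    using frechet_derivative_at[OF g[OF that]] .
  then have "Ck_on k S (\<lambda>x. frechet_derivative g (at x) v)" for v
    using Suc.prems by - (rule Suc.IH[of "\<lambda>x. frechet_derivative f (at x) v"], auto)
  with g show ?case by (auto simp: differentiable_def)
qed

text \<open>
  Class \<open>C\<^sup>k\<^sup>+\<^sup>1\<close> can be read off from any formula \<open>F\<close> for the differential. In the closure properties
  below, \<open>F\<close> comes from the differentiation rules and is built from functions to which the induction
  hypothesis on \<open>k\<close> applies.
\<close>

lemma Ck_on_SucI:
  assumes "open S" and "\<And>x. x \<in> S \<Longrightarrow> (f has_derivative F x) (at x)"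
    and "\<And>v. Ck_on k S (\<lambda>x. F x v)"
  shows "Ck_on (Suc k) S f"
proof -
  have "Ck_on k S (\<lambda>x. frechet_derivative f (at x) v)" for v
    using frechet_derivative_at[OF assms(2)] by (intro Ck_on_cong[OF assms(1,3)]) auto
  with assms(2) show ?thesis by (auto simp: differentiable_def)
qed

lemma Ck_on_has_derivative:
  assumes "Ck_on (Suc k) S f" and "x \<in> S"
  shows "(f has_derivative frechet_derivative f (at x)) (at x)"
  using assms by (simp add: frechet_derivative_works)

lemma Ck_on_lower: "Ck_on (Suc k) S f \<Longrightarrow> Ck_on k S f"
proof (induction k arbitrary: f)
  case 0
  then show ?case
    by (simp add: continuous_at_imp_continuous_on differentiable_imp_continuous_within)
qed auto

lemma Ck_on_linear:
  assumes "open S" and L: "bounded_linear L" and "Ck_on k S f"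
  shows "Ck_on k S (\<lambda>x. L (f x))"
  using assms(3)
proof (induction k arbitrary: f)
  case 0
  then show ?case by (simp add: bounded_linear.continuous_on[OF L])
next
  case (Suc k)
  show ?case
    by (rule Ck_on_SucI[OF assms(1) bounded_linear.has_derivative[OF L Ck_on_has_derivative]])
      (use Suc in auto)
qed

lemma Ck_on_add:
  assumes "open S" and "Ck_on k S f" and "Ck_on k S g"
  shows "Ck_on k S (\<lambda>x. f x + g x)"
  using assms(2,3)
proof (induction k arbitrary: f g)
  case 0
  then show ?case by (simp add: continuous_on_add)
next
  case (Suc k)
  show ?case
    by (rule Ck_on_SucI[OF assms(1) has_derivative_add[OF Ck_on_has_derivative Ck_on_has_derivative]])
      (use Suc in auto)
qed

lemma Ck_on_bilinear:
  assumes "open S" and B: "bounded_bilinear B" and "Ck_on k S f" and "Ck_on k S g"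
  shows "Ck_on k S (\<lambda>x. B (f x) (g x))"
  using assms(3,4)
proof (induction k arbitrary: f g)
  case 0
  then show ?case by (simp add: bounded_bilinear.continuous_on[OF B])
next
  case (Suc k)
  note lower = Ck_on_lower[OF Suc.prems(1)] Ck_on_lower[OF Suc.prems(2)]
  show ?case
    by (rule Ck_on_SucI[OF assms(1)
          bounded_bilinear.FDERIV[OF B Ck_on_has_derivative Ck_on_has_derivative]])
      (use Suc lower in \<open>auto intro!: Ck_on_add assms(1)\<close>)
qed

lemma Ck_on_inverse:
  fixes f :: "'a::real_normed_vector \<Rightarrow> 'b::real_normed_field"
  assumes "open S" and "Ck_on k S f" and "\<And>x. x \<in> S \<Longrightarrow> f x \<noteq> 0"
  shows "Ck_on k S (\<lambda>x. inverse (f x))"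
  using assms(2)
proof (induction k)
  case 0
  then show ?case by (simp add: continuous_on_inverse assms(3))
next
  case (Suc k)
  note inv = Suc.IH[OF Ck_on_lower[OF Suc.prems]]
  show ?case
    by (rule Ck_on_SucI[OF assms(1) Deriv.has_derivative_inverse[where f = f, OF assms(3) Ck_on_has_derivative]])
      (use Suc.prems inv in \<open>auto intro!: Ck_on_linear[OF assms(1) bounded_linear_minus[OF bounded_linear_ident]]
        Ck_on_bilinear[OF assms(1) bounded_bilinear_mult]\<close>)
qed

lemma Ck_on_holomorphic:
  assumes "open S" and "h holomorphic_on S"
  shows "Ck_on k S h"
  using assms(2)
proof (induction k arbitrary: h)
  case 0
  then show ?case by (simp add: holomorphic_on_imp_continuous_on)
next
  case (Suc k)
  have "(h has_derivative (\<lambda>v. deriv h x * v)) (at x)" if "x \<in> S" for x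
    using holomorphic_derivI[OF Suc.prems assms(1) that] by (simp add: has_field_derivative_def)
  then show ?case
    by (rule Ck_on_SucI[OF assms(1)])
      (use assms(1) Suc.prems in \<open>auto intro!: Suc.IH holomorphic_intros\<close>)
qed

text \<open>
  The real differential of \<open>g \<circ> f\<close> in direction \<open>v\<close> is the differential of \<open>g\<close> applied to
  \<open>f' v\<close>. Splitting \<open>f' v\<close> into real and imaginary parts writes it through the two partial
  derivatives of \<open>g\<close>, which are again compositions with \<open>f\<close>; this is what makes the induction on
  the order go through.
\<close>

lemma Ck_on_compose_holomorphic:
  assumes "open S" and "open T" and "f holomorphic_on S" and "f ` S \<subseteq> T" and "Ck_on k T g"
  shows "Ck_on k S (\<lambda>x. g (f x))"
  using assms(5)
proof (induction k arbitrary: g)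
  case 0
  then show ?case
    using continuous_on_compose2[OF _ holomorphic_on_imp_continuous_on[OF assms(3)] assms(4)]
    by simp
next
  case (Suc k)
  define G where "G w = frechet_derivative g (at w)" for w
  define F where "F x v = Re (deriv f x * v) *\<^sub>R G (f x) 1 + Im (deriv f x * v) *\<^sub>R G (f x) \<i>"
    for x v
  have "((\<lambda>x. g (f x)) has_derivative F x) (at x)" if "x \<in> S" for x
  proof -
    have f: "(f has_derivative (\<lambda>v. deriv f x * v)) (at x)"
      using holomorphic_derivI[OF assms(3,1) that] by (simp add: has_field_derivative_def)
    have g: "(g has_derivative G (f x)) (at (f x))"
      unfolding G_def using assms(4) that by (intro Ck_on_has_derivative[OF Suc.prems]) auto
    interpret G: bounded_linear "G (f x)" using g by (rule has_derivative_bounded_linear)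
    have split: "G (f x) u = Re u *\<^sub>R G (f x) 1 + Im u *\<^sub>R G (f x) \<i>" for u
    proof -
      have "u = Re u *\<^sub>R 1 + Im u *\<^sub>R \<i>" by (simp add: complex_eq_iff)
      then have "G (f x) u = G (f x) (Re u *\<^sub>R 1 + Im u *\<^sub>R \<i>)"
        by (rule arg_cong[where f = "G (f x)"])
      also have "\<dots> = Re u *\<^sub>R G (f x) 1 + Im u *\<^sub>R G (f x) \<i>"
        by (simp only: G.add G.scaleR)
      finally show ?thesis .
    qed
    have "(\<lambda>v. G (f x) (deriv f x * v)) = F x"
      by (rule ext) (unfold F_def, rule split)
    with has_derivative_compose[OF f g] show ?thesis by simp
  qed
  moreover have "Ck_on k S (\<lambda>x. F x v)" for v
  proof -
    have h: "Ck_on k S (\<lambda>x. deriv f x * v)"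
      using assms(1,3) by (intro Ck_on_holomorphic holomorphic_intros) auto
    have G: "Ck_on k S (\<lambda>x. G (f x) u)" for u
      unfolding G_def using Suc.prems
      by - (rule Suc.IH[of "\<lambda>w. frechet_derivative g (at w) u"], simp)
    note scale = Ck_on_bilinear[OF assms(1) bounded_bilinear_scaleR]
    show ?thesis
      unfolding F_def
      by (rule Ck_on_add[OF assms(1) scale[OF Ck_on_linear[OF assms(1) bounded_linear_Re h] G]
            scale[OF Ck_on_linear[OF assms(1) bounded_linear_Im h] G]])
  qed
  ultimately show ?case by (rule Ck_on_SucI[OF assms(1)])
qed

lemma smooth_on_has_derivative:
  "smooth_on S f \<Longrightarrow> x \<in> S \<Longrightarrow> (f has_derivative frechet_derivative f (at x)) (at x)"
  by (rule Ck_on_has_derivative[of 0]) (simp_all only: smooth_on_def)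

lemma smooth_on_directional_derivative:
  "smooth_on S f \<Longrightarrow> smooth_on S (\<lambda>x. frechet_derivative f (at x) v)"
  by (metis smooth_on_def Ck_on.simps(2))

lemma smooth_on_add:
  "open S \<Longrightarrow> smooth_on S f \<Longrightarrow> smooth_on S g \<Longrightarrow> smooth_on S (\<lambda>x. f x + g x)"
  by (simp add: smooth_on_def Ck_on_add)

lemma smooth_on_linear:
  "open S \<Longrightarrow> bounded_linear L \<Longrightarrow> smooth_on S f \<Longrightarrow> smooth_on S (\<lambda>x. L (f x))"
  by (simp add: smooth_on_def Ck_on_linear)

lemma smooth_on_mult:
  fixes f g :: "'a::real_normed_vector \<Rightarrow> 'b::real_normed_algebra"
  shows "open S \<Longrightarrow> smooth_on S f \<Longrightarrow> smooth_on S g \<Longrightarrow> smooth_on S (\<lambda>x. f x * g x)"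
  by (simp add: smooth_on_def Ck_on_bilinear[OF _ bounded_bilinear_mult])

lemma smooth_on_divide:
  fixes f g :: "'a::real_normed_vector \<Rightarrow> 'b::real_normed_field"
  assumes "open S" and "smooth_on S f" and "smooth_on S g" and "\<And>x. x \<in> S \<Longrightarrow> g x \<noteq> 0"
  shows "smooth_on S (\<lambda>x. f x / g x)"
  using assms by (simp add: divide_inverse smooth_on_mult smooth_on_def Ck_on_inverse
      Ck_on_bilinear[OF _ bounded_bilinear_mult])

text \<open>
  The logarithm reduces to division: the differential of \<open>ln f\<close> is \<open>f' / f\<close>.
\<close>

lemma smooth_on_ln:
  fixes f :: "'a::real_normed_vector \<Rightarrow> real"
  assumes "open S" and "smooth_on S f" and "\<And>x. x \<in> S \<Longrightarrow> f x > 0"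
  shows "smooth_on S (\<lambda>x. ln (f x))"
proof -
  have "((\<lambda>x. ln (f x)) has_derivative (\<lambda>v. frechet_derivative f (at x) v / f x)) (at x)"
    if "x \<in> S" for x
    using has_derivative_ln[OF assms(3)[OF that] smooth_on_has_derivative[OF assms(2) that]]
    by (simp add: divide_inverse)
  moreover have "smooth_on S (\<lambda>x. frechet_derivative f (at x) v / f x)" for v
    using assms(3) by (intro smooth_on_divide smooth_on_directional_derivative assms(1,2)) force
  ultimately have "Ck_on (Suc k) S (\<lambda>x. ln (f x))" for k
    using assms(1) by (intro Ck_on_SucI) (auto simp: smooth_on_def)
  then show ?thesis using Ck_on_lower unfolding smooth_on_def by blast
qed

lemma smooth_on_dz:
  assumes "open S" and "smooth_on S \<phi>"
  shows "smooth_on S (dz \<phi>)"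
proof -
  have part: "smooth_on S (\<lambda>z. c * frechet_derivative \<phi> (at z) v)" for c v
    using assms(1) bounded_linear_mult_right smooth_on_directional_derivative[OF assms(2)]
    by (rule smooth_on_linear)
  have "dz \<phi> = (\<lambda>z. 1 / 2 * frechet_derivative \<phi> (at z) 1
      + - \<i> / 2 * frechet_derivative \<phi> (at z) \<i>)"
    by (auto simp: dz_def field_simps)
  then show ?thesis using smooth_on_add[OF assms(1) part part] by (simp only:)
qed

lemma smooth_on_of_metric:
  assumes "open S" and "smooth_conformal_metric S \<rho>"
  shows "smooth_on S (\<lambda>z. complex_of_real (\<rho> z))"
  using assms
  by (auto simp: smooth_conformal_metric_def intro!: smooth_on_linear[OF _ bounded_linear_of_real])

lemma smooth_on_d_metric:
  assumes "open S" and "smooth_conformal_metric S \<rho>" and "smooth_on S \<phi>"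
  shows "smooth_on S (d_metric \<rho> \<phi>)"
proof -
  have "smooth_on S (\<lambda>z. dz \<phi> z / complex_of_real (\<rho> z))"
    using assms by (intro smooth_on_divide smooth_on_dz smooth_on_of_metric)
      (auto simp: smooth_conformal_metric_def)
  then show ?thesis by (simp add: d_metric_def[abs_def])
qed

lemma smooth_on_d_log:
  assumes "open S" and "smooth_conformal_metric S \<rho>"
  shows "smooth_on S (d_log \<rho>)"
  using assms unfolding d_log_def
  by (auto simp: smooth_conformal_metric_def
      intro!: smooth_on_d_metric smooth_on_linear[OF assms(1) bounded_linear_of_real] smooth_on_ln)

text \<open>
  The factor \<open>\<sigma> \<circ> f\<close> in \<open>D\<^sup>1 f\<close> and the term \<open>(\<partial>\<^sub>\<sigma> log \<sigma>) \<circ> f\<close> in the recursion are smooth functions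
  composed with the holomorphic \<open>f\<close>; everything else is built from smooth functions by \<open>\<partial>\<^sub>\<rho>\<close>, sums,
  products and division by the positive \<open>\<rho>\<close>.
\<close>

lemma smooth_on_PM_deriv:
  assumes "open \<Omega>" and "open \<Omega>'"
    and "smooth_conformal_metric \<Omega> \<rho>" and "smooth_conformal_metric \<Omega>' \<sigma>"
    and "f holomorphic_on \<Omega>" and "f ` \<Omega> \<subseteq> \<Omega>'"
  shows "smooth_on \<Omega> (PM_deriv \<sigma> \<rho> f (Suc n))"
proof -
  have compose: "smooth_on \<Omega> (\<lambda>z. g (f z))" if "smooth_on \<Omega>' g" for g :: "complex \<Rightarrow> complex"
    using that by (auto simp: smooth_on_def intro: Ck_on_compose_holomorphic[OF assms(1,2,5,6)])
  have f': "smooth_on \<Omega> (deriv f)"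
    using assms(1,5) by (simp add: smooth_on_def Ck_on_holomorphic holomorphic_deriv)
  have const: "smooth_on \<Omega> (\<lambda>_. c)" for c :: complex
    using assms(1) by (simp add: smooth_on_def Ck_on_holomorphic)
  have nz: "complex_of_real (\<rho> z) \<noteq> 0" if "z \<in> \<Omega>" for z
    using assms(3) that by (auto simp: smooth_conformal_metric_def)
  have D1: "smooth_on \<Omega> (PM_deriv \<sigma> \<rho> f (Suc 0))"
    unfolding PM_deriv.simps
    by (rule smooth_on_mult[OF assms(1) smooth_on_divide[OF assms(1)
            compose[OF smooth_on_of_metric[OF assms(2,4)]] smooth_on_of_metric[OF assms(1,3)] nz] f'])
  show ?thesis
  proof (induction n)
    case 0
    show ?case by (rule D1)
  next
    case (Suc n)
    show ?case
      unfolding PM_deriv.simps(2) One_nat_def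
      by (intro const smooth_on_add smooth_on_mult smooth_on_d_metric assms(1,3) Suc D1
          compose[OF smooth_on_d_log[OF assms(2,4)]] smooth_on_d_log)
  qed
qed

section \<open>The operator \<open>\<partial>\<^sub>\<rho>\<close> on the quotients \<open>Q\<^sup>n\<close>\<close>

lemma dz_eq:
  assumes "(\<phi> has_derivative D) (at z)"
  shows "dz \<phi> z = (D 1 - \<i> * D \<i>) / 2"
  using frechet_derivative_at[OF assms] by (simp add: dz_def)

lemma dz_divide:
  assumes "\<phi> differentiable (at z)" and "\<psi> differentiable (at z)" and "\<psi> z \<noteq> 0"
  shows "dz (\<lambda>z. \<phi> z / \<psi> z) z = dz \<phi> z / \<psi> z - \<phi> z * dz \<psi> z / (\<psi> z)\<^sup>2"
proof -
  note D = assms(1,2)[unfolded frechet_derivative_works]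
  show ?thesis
    unfolding dz_eq[OF has_derivative_divide'[OF D assms(3)]] unfolding dz_def using assms(3)
    by (simp add: field_simps power2_eq_square)
qed

lemma PM_deriv_1_nonzero:
  assumes "smooth_conformal_metric \<Omega> \<rho>" and "smooth_conformal_metric \<Omega>' \<sigma>"
    and "z \<in> \<Omega>" and "f z \<in> \<Omega>'" and "deriv f z \<noteq> 0"
  shows "PM_deriv \<sigma> \<rho> f 1 z \<noteq> 0"
proof -
  have "\<rho> z > 0" "\<sigma> (f z) > 0" using assms by (auto simp: smooth_conformal_metric_def)
  then show ?thesis using assms(5) by simp
qed

text \<open>
  The quotient rule applied to \<open>Q\<^sup>m f = D\<^sup>m\<^sup>+\<^sup>1 f / D\<^sup>1 f\<close>. The term \<open>(\<partial>\<^sub>\<sigma> log \<sigma>) \<circ> f \<cdot> D\<^sup>1 f\<close> enters the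
  logarithmic derivatives of \<open>D\<^sup>m\<^sup>+\<^sup>1 f\<close> and \<open>D\<^sup>1 f\<close> alike and cancels, while the multiples \<open>m + 1\<close>
  and \<open>1\<close> of \<open>\<partial>\<^sub>\<rho> log \<rho>\<close> differ by \<open>m\<close>. The formula includes \<open>m = 0\<close>, where \<open>Q\<^sup>0 f = 1\<close> makes
  both sides vanish.
\<close>

lemma d_metric_Q:
  assumes "\<And>k. PM_deriv \<sigma> \<rho> f (Suc k) differentiable (at z)" and "PM_deriv \<sigma> \<rho> f 1 z \<noteq> 0"
  shows "d_metric \<rho> (Q \<sigma> \<rho> f m) z =
    Q \<sigma> \<rho> f (m + 1) z - Q \<sigma> \<rho> f 1 z * Q \<sigma> \<rho> f m z + of_nat m * d_log \<rho> z * Q \<sigma> \<rho> f m z"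
proof -
  define D where "D n = PM_deriv \<sigma> \<rho> f n" for n
  define s where "s = d_log \<sigma> (f z)"
  define l where "l = d_log \<rho> z"
  have nz: "D 1 z \<noteq> 0" using assms(2) by (simp add: D_def)
  have step: "d_metric \<rho> (D (Suc k)) z
      = D (Suc (Suc k)) z + (of_nat (Suc k) * l - s * D 1 z) * D (Suc k) z" for k
    by (simp add: D_def s_def l_def algebra_simps)
  have "d_metric \<rho> (Q \<sigma> \<rho> f m) z = dz (\<lambda>z. D (Suc m) z / D 1 z) z / of_real (\<rho> z)"
    by (simp add: d_metric_def Q_def[abs_def] D_def)
  also have "\<dots> = (dz (D (Suc m)) z / D 1 z - D (Suc m) z * dz (D 1) z / (D 1 z)\<^sup>2)
      / of_real (\<rho> z)"
    using assms nz assms(1)[of 0] by (subst dz_divide) (auto simp: D_def)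
  also have "\<dots> = d_metric \<rho> (D (Suc m)) z / D 1 z
      - D (Suc m) z * d_metric \<rho> (D (Suc 0)) z / (D 1 z)\<^sup>2"
    by (simp add: d_metric_def diff_divide_distrib mult.commute)
  also have "\<dots> = D (Suc (Suc m)) z / D 1 z - D 2 z / D 1 z * (D (Suc m) z / D 1 z)
      + of_nat m * l * (D (Suc m) z / D 1 z)"
    unfolding step using nz by (simp add: field_simps power2_eq_square numeral_2_eq_2)
  finally show ?thesis by (simp add: Q_def D_def l_def numeral_2_eq_2)
qed

section \<open>Evaluation of polynomials\<close>

definition mono_eval :: "(nat \<Rightarrow> complex) \<Rightarrow> (nat \<Rightarrow>\<^sub>0 nat) \<Rightarrow> complex" where
  "mono_eval a t = (\<Prod>i\<in>Poly_Mapping.keys t. a i ^ Poly_Mapping.lookup t i)"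

lemma mono_eval_superset:
  assumes "finite A" and "Poly_Mapping.keys t \<subseteq> A"
  shows "mono_eval a t = (\<Prod>i\<in>A. a i ^ Poly_Mapping.lookup t i)"
  unfolding mono_eval_def
  by (rule prod.mono_neutral_left) (use assms in \<open>auto simp: in_keys_iff\<close>)

lemma mono_eval_add: "mono_eval a (s + t) = mono_eval a s * mono_eval a t"
proof -
  let ?A = "Poly_Mapping.keys s \<union> Poly_Mapping.keys t"
  have "mono_eval a (s + t) = (\<Prod>i\<in>?A. a i ^ Poly_Mapping.lookup (s + t) i)"
    by (rule mono_eval_superset) (auto simp: Poly_Mapping.keys_add)
  also have "\<dots> = mono_eval a s * mono_eval a t"
    by (simp add: mono_eval_superset[of ?A] lookup_add power_add prod.distrib)
  finally show ?thesis .
qed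

lemma poly_eval_superset:
  assumes "finite A" and "Poly_Mapping.keys P \<subseteq> A"
  shows "poly_eval a P =
    (\<Sum>t\<in>A. of_real (real_of_float (Poly_Mapping.lookup P t)) * mono_eval a t)"
  unfolding poly_eval_def mono_eval_def[symmetric]
  by (rule sum.mono_neutral_left) (use assms in \<open>auto simp: in_keys_iff\<close>)

lemma poly_eval_single [simp]:
  "poly_eval a (Poly_Mapping.single t c) = of_real (real_of_float c) * mono_eval a t"
  by (subst poly_eval_superset[of "{t}"]) auto

lemma poly_eval_0 [simp]: "poly_eval a 0 = 0"
  by (simp add: poly_eval_def)

lemma poly_eval_add [simp]: "poly_eval a (P + R) = poly_eval a P + poly_eval a R"
proof -
  let ?A = "Poly_Mapping.keys P \<union> Poly_Mapping.keys R"
  have "poly_eval a (P + R)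
      = (\<Sum>t\<in>?A. of_real (real_of_float (Poly_Mapping.lookup (P + R) t)) * mono_eval a t)"
    by (rule poly_eval_superset) (auto simp: Poly_Mapping.keys_add)
  then show ?thesis
    by (simp add: poly_eval_superset[of ?A] lookup_add distrib_right sum.distrib)
qed

lemma poly_eval_uminus [simp]: "poly_eval a (- P) = - poly_eval a P"
  using poly_eval_add[of a P "- P"] by (simp add: add_eq_0_iff2 del: poly_eval_add)

lemma poly_eval_diff [simp]: "poly_eval a (P - R) = poly_eval a P - poly_eval a R"
  using poly_eval_add[of a P "- R"] by simp

lemma poly_eval_sum [simp]: "poly_eval a (sum F I) = (\<Sum>i\<in>I. poly_eval a (F i))"
  by (induction I rule: infinite_finite_induct) auto

lemma poly_as_sum:
  "P = (\<Sum>t\<in>Poly_Mapping.keys P. Poly_Mapping.single t (Poly_Mapping.lookup P t))"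
  for P :: "'a \<Rightarrow>\<^sub>0 'b::comm_monoid_add"
  by (rule poly_mapping_eqI)
    (simp add: lookup_sum lookup_single when_def in_keys_iff)

lemma poly_eval_mult [simp]: "poly_eval a (P * R) = poly_eval a P * poly_eval a R"
proof -
  have single: "poly_eval a (Poly_Mapping.single s c * Poly_Mapping.single t d)
      = poly_eval a (Poly_Mapping.single s c) * poly_eval a (Poly_Mapping.single t d)" for s t c d
    by (simp add: mult_single mono_eval_add)
  have "poly_eval a (P * R)
      = poly_eval a ((\<Sum>s\<in>Poly_Mapping.keys P. Poly_Mapping.single s (Poly_Mapping.lookup P s))
          * (\<Sum>t\<in>Poly_Mapping.keys R. Poly_Mapping.single t (Poly_Mapping.lookup R t)))"
    using poly_as_sum[of P] poly_as_sum[of R] by simp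
  also have "\<dots> = poly_eval a (\<Sum>s\<in>Poly_Mapping.keys P. Poly_Mapping.single s (Poly_Mapping.lookup P s))
          * poly_eval a (\<Sum>t\<in>Poly_Mapping.keys R. Poly_Mapping.single t (Poly_Mapping.lookup R t))"
    by (simp add: sum_product single del: poly_eval_single)
  finally show ?thesis
    using poly_as_sum[of P] poly_as_sum[of R] by simp
qed

lemma poly_eval_1 [simp]: "poly_eval a 1 = 1"
  using poly_eval_single[of a 0 1] by (simp add: mono_eval_def del: poly_eval_single)

lemma poly_eval_of_nat [simp]: "poly_eval a (of_nat n) = of_nat n"
  by (induction n) auto

lemma poly_eval_Const [simp]: "poly_eval a (Const c) = of_real (real_of_float c)"
  by (simp add: Const_def mono_eval_def)

lemma poly_eval_X [simp]: "poly_eval a (X m) = a m"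
  by (simp add: X_def mono_eval_def)

section \<open>Chain rule and weighted homogeneity\<close>

definition poly_vars :: "dyadic_poly \<Rightarrow> nat set" where
  "poly_vars P = (\<Union>t\<in>Poly_Mapping.keys P. Poly_Mapping.keys t)"

lemma finite_poly_vars [simp]: "finite (poly_vars P)"
  by (simp add: poly_vars_def)

lemma pdiff_outside_vars: "m \<notin> poly_vars P \<Longrightarrow> pdiff m P = 0"
  unfolding pdiff_def by (rule sum.neutral) (auto simp: poly_vars_def in_keys_iff)

lemma real_of_float_of_nat [simp]: "real_of_float (of_nat n) = of_nat n"
  by (induction n) auto

lemma poly_eval_pdiff:
  "poly_eval a (pdiff m P) = (\<Sum>t\<in>Poly_Mapping.keys P.
     of_real (real_of_float (Poly_Mapping.lookup P t)) *
       (of_nat (Poly_Mapping.lookup t m) * mono_eval a (t - Poly_Mapping.single m 1)))"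
  by (simp add: pdiff_def mult_ac)

text \<open>
  A finite index set for the sum in \<open>\<E>\<close>, matching the one in the chain rule up to the variable \<open>x\<^sub>0\<close>.
\<close>

lemma E_op_eq:
  "E_op P = (\<Sum>m\<in>poly_vars P - {0}. (X (m + 1) - X 1 * X m) * pdiff m P)"
proof -
  have "E_op P = (\<Sum>m\<in>poly_vars P. (X (m + 1) - X 1 * X m) * pdiff m P when m \<ge> 1)"
    unfolding E_op_def
    by (rule Sum_any.expand_superset) (auto intro: ccontr simp: pdiff_outside_vars)
  also have "\<dots> = (\<Sum>m\<in>poly_vars P - {0}. (X (m + 1) - X 1 * X m) * pdiff m P)"
    by (rule sum.mono_neutral_cong_right) auto
  finally show ?thesis .
qed

text \<open>
  The monomial left after lowering the exponent of \<open>x\<^sub>m\<close>, in the form in which the product rule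
  produces it.
\<close>

lemma mono_eval_remove:
  assumes "m \<in> Poly_Mapping.keys t"
  shows "mono_eval a (t - Poly_Mapping.single m 1) = a m ^ (Poly_Mapping.lookup t m - 1)
    * (\<Prod>i\<in>Poly_Mapping.keys t - {m}. a i ^ Poly_Mapping.lookup t i)"
proof -
  have "mono_eval a (t - Poly_Mapping.single m 1)
      = (\<Prod>i\<in>Poly_Mapping.keys t. a i ^ Poly_Mapping.lookup (t - Poly_Mapping.single m 1) i)"
    by (rule mono_eval_superset) (auto simp: in_keys_iff lookup_minus)
  also have "\<dots> = a m ^ (Poly_Mapping.lookup t m - 1)
    * (\<Prod>i\<in>Poly_Mapping.keys t - {m}. a i ^ Poly_Mapping.lookup t i)"
    using assms by (subst prod.remove[of _ m]) (auto simp: lookup_minus lookup_single when_def intro!: prod.cong)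
  finally show ?thesis .
qed

lemma has_derivative_mono_eval:
  assumes "\<And>m. (a m has_derivative a' m) (at z)"
  shows "((\<lambda>z. mono_eval (\<lambda>m. a m z) t) has_derivative
    (\<lambda>v. \<Sum>m\<in>Poly_Mapping.keys t. of_nat (Poly_Mapping.lookup t m)
        * mono_eval (\<lambda>m. a m z) (t - Poly_Mapping.single m 1) * a' m v)) (at z)"
proof -
  have "((\<lambda>z. mono_eval (\<lambda>m. a m z) t) has_derivative
    (\<lambda>v. \<Sum>m\<in>Poly_Mapping.keys t.
        (of_nat (Poly_Mapping.lookup t m) * a' m v * a m z ^ (Poly_Mapping.lookup t m - 1))
        * (\<Prod>i\<in>Poly_Mapping.keys t - {m}. a i z ^ Poly_Mapping.lookup t i))) (at z)"
    unfolding mono_eval_def by (intro has_derivative_prod has_derivative_power assms)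
  also have "(\<lambda>v. \<Sum>m\<in>Poly_Mapping.keys t.
        (of_nat (Poly_Mapping.lookup t m) * a' m v * a m z ^ (Poly_Mapping.lookup t m - 1))
        * (\<Prod>i\<in>Poly_Mapping.keys t - {m}. a i z ^ Poly_Mapping.lookup t i))
     = (\<lambda>v. \<Sum>m\<in>Poly_Mapping.keys t. of_nat (Poly_Mapping.lookup t m)
        * mono_eval (\<lambda>m. a m z) (t - Poly_Mapping.single m 1) * a' m v)"
    by (intro ext sum.cong) (simp_all add: mono_eval_remove mult_ac del: One_nat_def)
  finally show ?thesis .
qed

text \<open>
  The first-order operator \<open>\<Sum> c\<^sub>m \<partial>/\<partial>x\<^sub>m\<close>, computed monomial by monomial. Both the chain rule and
  Euler's identity are instances, with \<open>c\<^sub>m\<close> the differential of the \<open>m\<close>-th argument and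
  \<open>c\<^sub>m = m x\<^sub>m\<close> respectively.
\<close>

lemma sum_vars_pdiff:
  "(\<Sum>m\<in>poly_vars P. poly_eval a (pdiff m P) * c m) = (\<Sum>t\<in>Poly_Mapping.keys P.
     of_real (real_of_float (Poly_Mapping.lookup P t)) * (\<Sum>m\<in>Poly_Mapping.keys t.
       of_nat (Poly_Mapping.lookup t m) * mono_eval a (t - Poly_Mapping.single m 1) * c m))"
proof -
  have "(\<Sum>m\<in>Poly_Mapping.keys t.
       of_nat (Poly_Mapping.lookup t m) * mono_eval a (t - Poly_Mapping.single m 1) * c m)
     = (\<Sum>m\<in>poly_vars P.
       of_nat (Poly_Mapping.lookup t m) * mono_eval a (t - Poly_Mapping.single m 1) * c m)"
    if "t \<in> Poly_Mapping.keys P" for t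
    by (rule sum.mono_neutral_left) (use that in \<open>auto simp: poly_vars_def in_keys_iff\<close>)
  then show ?thesis
    by (simp add: poly_eval_pdiff sum_distrib_left sum_distrib_right mult.assoc
        sum.swap[of _ "poly_vars P"] cong: sum.cong)
qed

lemma has_derivative_poly_eval:
  assumes "\<And>m. (a m has_derivative a' m) (at z)"
  shows "((\<lambda>z. poly_eval (\<lambda>m. a m z) P) has_derivative
    (\<lambda>v. \<Sum>m\<in>poly_vars P. poly_eval (\<lambda>m. a m z) (pdiff m P) * a' m v)) (at z)"
  unfolding sum_vars_pdiff unfolding poly_eval_def mono_eval_def[symmetric]
  by (intro has_derivative_sum has_derivative_mult_right has_derivative_mono_eval assms)

lemma d_metric_poly_eval:
  assumes "\<And>m. a m differentiable (at z)"
  shows "d_metric \<rho> (\<lambda>z. poly_eval (\<lambda>m. a m z) P) z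
    = (\<Sum>m\<in>poly_vars P. poly_eval (\<lambda>m. a m z) (pdiff m P) * d_metric \<rho> (a m) z)"
  unfolding d_metric_def dz_eq[OF has_derivative_poly_eval[OF assms[unfolded frechet_derivative_works]]]
  unfolding dz_def
  by (simp add: sum_distrib_left sum_subtractf[symmetric] sum_divide_distrib algebra_simps)

text \<open>
  Weights are integers because \<open>\<partial>/\<partial>x\<^sub>m\<close> lowers them by \<open>m\<close>: the derivative of a polynomial of weight
  \<open>d\<close> has weight \<open>d - m\<close> also for \<open>m > d\<close>, where it is the zero polynomial, which is homogeneous of
  every weight.
\<close>

definition weight :: "(nat \<Rightarrow>\<^sub>0 nat) \<Rightarrow> int" where
  "weight t = (\<Sum>i\<in>Poly_Mapping.keys t. int (i * Poly_Mapping.lookup t i))"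

definition weighted_homogeneous :: "int \<Rightarrow> dyadic_poly \<Rightarrow> bool" where
  "weighted_homogeneous d P \<longleftrightarrow> (\<forall>t\<in>Poly_Mapping.keys P. weight t = d)"

lemma weight_superset:
  assumes "finite A" and "Poly_Mapping.keys t \<subseteq> A"
  shows "weight t = (\<Sum>i\<in>A. int (i * Poly_Mapping.lookup t i))"
  unfolding weight_def
  by (rule sum.mono_neutral_left) (use assms in \<open>auto simp: in_keys_iff\<close>)

lemma weight_single [simp]: "weight (Poly_Mapping.single m k) = int (m * k)"
  by (subst weight_superset[of "{m}"]) auto

lemma weight_add [simp]: "weight (s + t) = weight s + weight t"
proof -
  let ?A = "Poly_Mapping.keys s \<union> Poly_Mapping.keys t"
  have "weight (s + t) = (\<Sum>i\<in>?A. int (i * Poly_Mapping.lookup (s + t) i))"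
    by (rule weight_superset) (auto simp: Poly_Mapping.keys_add)
  then show ?thesis
    by (simp add: weight_superset[of ?A] lookup_add distrib_left sum.distrib)
qed

lemma remove_variable_add:
  assumes "m \<in> Poly_Mapping.keys (t :: nat \<Rightarrow>\<^sub>0 nat)"
  shows "t - Poly_Mapping.single m 1 + Poly_Mapping.single m 1 = t"
  using assms by (intro poly_mapping_eqI) (auto simp: lookup_add lookup_minus lookup_single when_def in_keys_iff)

lemma homogeneous_add:
  "weighted_homogeneous d P \<Longrightarrow> weighted_homogeneous d R \<Longrightarrow> weighted_homogeneous d (P + R)"
  using Poly_Mapping.keys_add[of P R] by (auto simp: weighted_homogeneous_def)

lemma homogeneous_diff:
  "weighted_homogeneous d P \<Longrightarrow> weighted_homogeneous d R \<Longrightarrow> weighted_homogeneous d (P - R)"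
  using keys_diff[of P R] by (auto simp: weighted_homogeneous_def)

lemma homogeneous_0: "weighted_homogeneous d 0"
  by (simp add: weighted_homogeneous_def)

lemma homogeneous_sum:
  "(\<And>i. i \<in> I \<Longrightarrow> weighted_homogeneous d (F i)) \<Longrightarrow> weighted_homogeneous d (sum F I)"
  by (induction I rule: infinite_finite_induct) (auto simp: homogeneous_add homogeneous_0)

lemma homogeneous_mult:
  assumes "weighted_homogeneous d P" and "weighted_homogeneous e R" and "d + e = k"
  shows "weighted_homogeneous k (P * R)"
  using keys_mult[of P R] assms by (fastforce simp: weighted_homogeneous_def)

lemma homogeneous_single:
  "weight t = d \<Longrightarrow> weighted_homogeneous d (Poly_Mapping.single t c)"
  by (simp add: weighted_homogeneous_def)

lemma homogeneous_Const: "weighted_homogeneous 0 (Const c)"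
  by (simp add: Const_def homogeneous_single weight_def)

lemma homogeneous_1: "weighted_homogeneous 0 1"
  using homogeneous_single[of 0 0 1] by (simp add: weight_def)

lemma homogeneous_of_nat: "weighted_homogeneous 0 (of_nat n)"
  by (induction n) (simp_all add: homogeneous_0 homogeneous_1 homogeneous_add)

lemma homogeneous_X: "weighted_homogeneous (int m) (X m)"
  by (simp add: X_def homogeneous_single)

lemma homogeneous_pdiff:
  assumes "weighted_homogeneous d P"
  shows "weighted_homogeneous (d - int m) (pdiff m P)"
  unfolding pdiff_def
proof (rule homogeneous_sum)
  fix t assume t: "t \<in> Poly_Mapping.keys P"
  show "weighted_homogeneous (d - int m) (Poly_Mapping.single (t - Poly_Mapping.single m 1)
       (of_nat (Poly_Mapping.lookup t m) * Poly_Mapping.lookup P t))"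
  proof (cases "m \<in> Poly_Mapping.keys t")
    case True
    have "weight (t - Poly_Mapping.single m 1) + int m = weight t"
      using arg_cong[OF remove_variable_add[OF True], of weight] by simp
    then show ?thesis
      using assms t by (intro homogeneous_single) (auto simp: weighted_homogeneous_def)
  qed (simp add: in_keys_iff homogeneous_0)
qed

lemma homogeneous_E_op:
  assumes "weighted_homogeneous d P"
  shows "weighted_homogeneous (d + 1) (E_op P)"
  unfolding E_op_eq
proof (intro homogeneous_sum)
  fix m
  have "weighted_homogeneous (int (m + 1)) (X (m + 1) - X 1 * X m)"
    by (intro homogeneous_diff homogeneous_X homogeneous_mult[OF homogeneous_X homogeneous_X]) simp
  then show "weighted_homogeneous (d + 1) ((X (m + 1) - X 1 * X m) * pdiff m P)"
    by (rule homogeneous_mult[OF _ homogeneous_pdiff[OF assms]]) simp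
qed

lemma homogeneous_P_poly: "weighted_homogeneous (int n) (P_poly n)"
proof (induction n rule: less_induct)
  case (less n)
  consider "n = 0" | "n = 1" | "n = 2" | "n \<ge> 3" by linarith
  then show ?case
  proof cases
    case 3
    have "weighted_homogeneous 2 (X 2 - Const (Float 3 (-1)) * X 1 ^ 2)"
      unfolding power2_eq_square using homogeneous_X[of 2]
      by (intro homogeneous_diff homogeneous_mult[OF homogeneous_Const
            homogeneous_mult[OF homogeneous_X homogeneous_X]]) auto
    with 3 show ?thesis by (simp add: numeral_2_eq_2)
  next
    case 4
    have "weighted_homogeneous (int n) (E_op (P_poly (n - 1)))"
      using homogeneous_E_op[OF less[of "n - 1"]] 4 by (simp add: of_nat_diff)
    moreover have "weighted_homogeneous (int n - 2)
        (\<Sum>k = 1..n-1. of_nat (n choose k) * P_poly (k - 1) * P_poly (n - k - 1))"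
    proof (rule homogeneous_sum)
      fix k assume k: "k \<in> {1..n-1}"
      show "weighted_homogeneous (int n - 2)
          (of_nat (n choose k) * P_poly (k - 1) * P_poly (n - k - 1))"
        by (rule homogeneous_mult[OF homogeneous_mult[OF homogeneous_of_nat less[of "k - 1"] refl]
              less[of "n - k - 1"]]) (use k in auto)
    qed
    moreover have "weighted_homogeneous 2 (Const (Float 1 (-1)) * P_poly 2)"
      using less[of 2] 4 by (intro homogeneous_mult[OF homogeneous_Const]) auto
    ultimately show ?thesis
      using 4 by (simp only: P_poly.simps(4)) (intro homogeneous_add, assumption, rule homogeneous_mult, auto)
  qed (auto simp: homogeneous_0 homogeneous_1)
qed

text \<open>
  Euler's identity: multiplying \<open>\<partial>x\<^sup>t/\<partial>x\<^sub>m\<close> by \<open>m x\<^sub>m\<close> restores the monomial \<open>x\<^sup>t\<close> with the factor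
  \<open>m t\<^sub>m\<close>, and these factors add up to the weight of \<open>x\<^sup>t\<close>.
\<close>

lemma euler_homogeneous:
  assumes "weighted_homogeneous d P"
  shows "(\<Sum>m\<in>poly_vars P. poly_eval a (pdiff m P) * (of_nat m * a m)) = of_int d * poly_eval a P"
proof -
  have "(\<Sum>m\<in>Poly_Mapping.keys t. of_nat (Poly_Mapping.lookup t m)
         * mono_eval a (t - Poly_Mapping.single m 1) * (of_nat m * a m))
       = of_int d * mono_eval a t" if t: "t \<in> Poly_Mapping.keys P" for t
  proof -
    have "mono_eval a (t - Poly_Mapping.single m 1) * a m = mono_eval a t"
      if "m \<in> Poly_Mapping.keys t" for m
      using mono_eval_add[of a "t - Poly_Mapping.single m 1" "Poly_Mapping.single m 1"]
        remove_variable_add[OF that]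
      by (simp add: mono_eval_def[of a "Poly_Mapping.single m 1"] del: One_nat_def)
    then have "(\<Sum>m\<in>Poly_Mapping.keys t. of_nat (Poly_Mapping.lookup t m)
         * mono_eval a (t - Poly_Mapping.single m 1) * (of_nat m * a m))
       = (\<Sum>m\<in>Poly_Mapping.keys t. of_nat (m * Poly_Mapping.lookup t m) * mono_eval a t)"
      by (intro sum.cong) (simp_all add: mult_ac del: One_nat_def)
    also have "\<dots> = of_int (weight t) * mono_eval a t"
      by (simp add: weight_def sum_distrib_right)
    finally show ?thesis using assms t by (simp add: weighted_homogeneous_def)
  qed
  then show ?thesis
    unfolding sum_vars_pdiff
    by (simp add: poly_eval_def mono_eval_def[symmetric] sum_distrib_left mult.left_commute
        del: One_nat_def)
qed

text \<open>
  The bridge between functions and polynomials, to be used with \<open>l = \<partial>\<^sub>\<rho> log \<rho>\<close> and \<open>a\<^sub>m = Q\<^sup>m f\<close>. The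
  operator \<open>\<E>\<close> leaves out the variable \<open>x\<^sub>0\<close>, over which the chain rule ranges as well; the value
  \<open>a\<^sub>0(z) = 1\<close> reconciles them, because it makes the coefficient \<open>a\<^sub>1 - a\<^sub>1 a\<^sub>0\<close> of \<open>\<partial>/\<partial>x\<^sub>0\<close> vanish.
\<close>

lemma d_metric_poly_eval_homogeneous:
  assumes "\<And>m. a m differentiable (at z)"
    and "a 0 z = 1"
    and "\<And>m. d_metric \<rho> (a m) z = a (m + 1) z - a 1 z * a m z + of_nat m * l * a m z"
    and "weighted_homogeneous d P"
  shows "d_metric \<rho> (\<lambda>z. poly_eval (\<lambda>m. a m z) P) z
    = poly_eval (\<lambda>m. a m z) (E_op P) + of_int d * l * poly_eval (\<lambda>m. a m z) P"
proof -
  let ?e = "poly_eval (\<lambda>m. a m z)"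
  have "d_metric \<rho> (\<lambda>z. poly_eval (\<lambda>m. a m z) P) z
      = (\<Sum>m\<in>poly_vars P. ?e (pdiff m P) * (a (m + 1) z - a 1 z * a m z))
        + l * (\<Sum>m\<in>poly_vars P. ?e (pdiff m P) * (of_nat m * a m z))"
    unfolding d_metric_poly_eval[OF assms(1)] assms(3)
    by (simp add: sum_distrib_left sum.distrib[symmetric] algebra_simps)
  also have "(\<Sum>m\<in>poly_vars P. ?e (pdiff m P) * (a (m + 1) z - a 1 z * a m z)) = ?e (E_op P)"
    unfolding E_op_eq poly_eval_sum
    by (rule sum.mono_neutral_cong_right) (auto simp: assms(2) mult_ac)
  finally show ?thesis by (simp add: euler_homogeneous[OF assms(4)])
qed

section \<open>The recursion for the invariant Schwarzian derivatives\<close>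

theorem theorem4p4:
  fixes \<Omega> \<Omega>' :: "complex set" and \<rho> \<sigma> :: "complex \<Rightarrow> real"
    and f :: "complex \<Rightarrow> complex" and n :: nat and z :: complex
  assumes "plane_domain \<Omega>" and "plane_domain \<Omega>'"
    and "smooth_conformal_metric \<Omega> \<rho>" and "smooth_conformal_metric \<Omega>' \<sigma>"
    and "f holomorphic_on \<Omega>" and "f ` \<Omega> \<subseteq> \<Omega>'" and "\<not> f constant_on \<Omega>"
    and "n \<ge> 3" and "z \<in> \<Omega>" and "deriv f z \<noteq> 0"
  shows "inv_Schwarzian \<sigma> \<rho> f n z =
           d_metric \<rho> (inv_Schwarzian \<sigma> \<rho> f (n - 1)) z
             - of_nat (n - 1) * d_log \<rho> z * inv_Schwarzian \<sigma> \<rho> f (n - 1) z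
           + 1 / 2 * inv_Schwarzian \<sigma> \<rho> f 2 z *
             (\<Sum>k = 1..n-1. of_nat (n choose k) * inv_Schwarzian \<sigma> \<rho> f (k - 1) z
                              * inv_Schwarzian \<sigma> \<rho> f (n - k - 1) z)"
proof -
  let ?e = "poly_eval (\<lambda>m. Q \<sigma> \<rho> f m z)"
  have D: "PM_deriv \<sigma> \<rho> f (Suc k) differentiable (at z)" for k
    using smooth_on_has_derivative[OF smooth_on_PM_deriv[OF _ _ assms(3-6)] assms(9)] assms(1,2)
    by (auto simp: plane_domain_def differentiable_def)
  have nz: "PM_deriv \<sigma> \<rho> f 1 z \<noteq> 0"
    using assms(6,9) by (intro PM_deriv_1_nonzero[OF assms(3,4,9) _ assms(10)]) auto
  have Qd: "Q \<sigma> \<rho> f m differentiable (at z)" for m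
    unfolding Q_def[abs_def] using D[of m] D[of 0] nz
    by (auto intro!: differentiable_divide simp del: PM_deriv.simps)
  have "d_metric \<rho> (inv_Schwarzian \<sigma> \<rho> f (n - 1)) z
      = ?e (E_op (P_poly (n - 1))) + of_int (int (n - 1)) * d_log \<rho> z * ?e (P_poly (n - 1))"
    unfolding inv_Schwarzian_def[abs_def]
    by (rule d_metric_poly_eval_homogeneous[OF Qd _ d_metric_Q[OF D nz] homogeneous_P_poly])
      (use nz in \<open>simp add: Q_def\<close>)
  moreover have "real_of_float (Float 1 (- 1)) = 1 / 2"
    by (simp add: powr_minus)
  ultimately show ?thesis
    using assms(8) by (simp add: inv_Schwarzian_def P_poly.simps(4)[of n] del: P_poly.simps)
qed

end
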